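(* Let $X\subseteq 2^{\mathbb{Z}}$ be a subshift of finite type, let $E$ be the shift equivalence relation on $X$, and assume $E$ has uncountably many classes. Then for every reasonable pointclass $\boldsymbol{\Gamma}$, $(\boldsymbol{\Gamma},E)$-determinacy implies $\boldsymbol{\Gamma}$-determinacy.
   Context: A subshift of finite type is a set of the form $X=\{x\in 2^{\mathbb{Z}}: x \text{ contains no occurrence of any of } w_1,\dots,w_e\}$ for finitely many finite binary words $w_1,\dots,w_e$ (i.e., no restriction of $x$ to an interval of consecutive integers equals some $w_\ell$). The shift equivalence relation $E$ on $X$ is: $x\,E\,y$ iff $y(k)=x(k+m)$ for all $k$, for some $m\in\mathbb{Z}$. A pointclass is a collection of subsets of Polish spaces closed under continuous preimages; it is reasonable if it is closed under unions and intersections with $\boldsymbol{\Delta}^0_6$ sets and under substitutions by $\boldsymbol{\Delta}^0_6$-measurable functions. $(\boldsymbol{\Gamma},E)$-determinacy means: for every continuous surjection $\pi:\omega^\omega\to X$ and every $E$-invariant $A\subseteq X$ in $\boldsymbol{\Gamma}$, the set $\pi^{-1}(A)\subseteq\omega^\omega$ is determined (Gale–Stewart game on natural numbers). $\boldsymbol{\Gamma}$-determinacy means every set in $\boldsymbol{\Gamma}$ is determined. *)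

theory Defs
  imports "HOL-Analysis.Analysis"
begin

definition polish :: "'a topology \<Rightarrow> bool" where
  "polish T \<longleftrightarrow> completely_metrizable_space T \<and> separable_space T"

definition baire :: "(nat \<Rightarrow> nat) topology" where
  "baire = product_topology (\<lambda>_. discrete_topology UNIV) UNIV"

definition cantorZ :: "(int \<Rightarrow> bool) topology" where
  "cantorZ = product_topology (\<lambda>_. discrete_topology UNIV) UNIV"

text \<open>
  The finite levels of the boldface Borel hierarchy, numbered from 1. Taking complements at the
  preceding level only is enough, since the levels are increasing in metrizable spaces.
\<close>

fun Sigma0 :: "'a topology \<Rightarrow> nat \<Rightarrow> 'a set set" where
  "Sigma0 T 0 = {}"
| "Sigma0 T (Suc 0) = {U. openin T U}"
| "Sigma0 T (Suc (Suc n)) =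
    {\<Union>k::nat. topspace T - B k | B. \<forall>k. B k \<in> Sigma0 T (Suc n)}"

definition Pi0 :: "'a topology \<Rightarrow> nat \<Rightarrow> 'a set set" where
  "Pi0 T n = {topspace T - B | B. B \<in> Sigma0 T n}"

definition Delta0 :: "'a topology \<Rightarrow> nat \<Rightarrow> 'a set set" where
  "Delta0 T n = Sigma0 T n \<inter> Pi0 T n"

definition Delta0_measurable :: "nat \<Rightarrow> 'a topology \<Rightarrow> 'b topology \<Rightarrow> ('a \<Rightarrow> 'b) \<Rightarrow> bool" where
  "Delta0_measurable n S T f \<longleftrightarrow>
     f \<in> topspace S \<rightarrow> topspace T \<and>
     (\<forall>U. openin T U \<longrightarrow> {x \<in> topspace S. f x \<in> U} \<in> Delta0 S n)"

text \<open>
  A pointclass assigns to every Polish space a family of its subsets. HOL cannot quantify over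
  all types, so a pointclass is given by its values on the Polish spaces whose points are taken
  from the type \<^typ>\<open>nat \<Rightarrow> nat\<close> (carrying any Polish topology, on any subset of the type). Every
  Polish space has at most continuum many points, hence a homeomorphic copy of this kind
  (\<open>polish_copy\<close> below). Membership of a subset of an arbitrary Polish space is membership of its
  image in such a copy, and does not depend on the copy (\<open>in_pointclass_iff\<close> below), because
  closure under continuous preimages forces invariance under homeomorphisms.
\<close>

type_synonym point_family = "(nat \<Rightarrow> nat) topology \<Rightarrow> (nat \<Rightarrow> nat) set set"

definition pointclass :: "point_family \<Rightarrow> bool" where
  "pointclass \<Gamma> \<longleftrightarrow>
     (\<forall>T. \<forall>A\<in>\<Gamma> T. polish T \<and> A \<subseteq> topspace T) \<and>
     (\<forall>S T f A. polish S \<longrightarrow> polish T \<longrightarrow> continuous_map S T f \<longrightarrow> A \<in> \<Gamma> T \<longrightarrow>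
        {x \<in> topspace S. f x \<in> A} \<in> \<Gamma> S)"

definition reasonable :: "point_family \<Rightarrow> bool" where
  "reasonable \<Gamma> \<longleftrightarrow> pointclass \<Gamma> \<and>
     (\<forall>T A B. polish T \<longrightarrow> A \<in> \<Gamma> T \<longrightarrow> B \<in> Delta0 T 6 \<longrightarrow> A \<union> B \<in> \<Gamma> T \<and> A \<inter> B \<in> \<Gamma> T) \<and>
     (\<forall>S T f A. polish S \<longrightarrow> polish T \<longrightarrow> Delta0_measurable 6 S T f \<longrightarrow> A \<in> \<Gamma> T \<longrightarrow>
        {x \<in> topspace S. f x \<in> A} \<in> \<Gamma> S)"

definition in_pointclass :: "point_family \<Rightarrow> 'a topology \<Rightarrow> 'a set \<Rightarrow> bool" where
  "in_pointclass \<Gamma> T A \<longleftrightarrow>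
     A \<subseteq> topspace T \<and> (\<exists>S h. polish S \<and> homeomorphic_map T S h \<and> h ` A \<in> \<Gamma> S)"

lemma polish_homeomorphic:
  assumes "polish T" "T homeomorphic_space S"
  shows "polish S"
proof -
  obtain h where h: "homeomorphic_map T S h"
    using assms(2) homeomorphic_space by blast
  have "separable_space S"
    using assms(1) h homeomorphic_map_def polish_def separable_space_quotient_map_image by blast
  then show ?thesis
    using assms homeomorphic_completely_metrizable_space unfolding polish_def by blast
qed

lemma polish_inj:
  assumes "polish (T :: 'a topology)"
  obtains f :: "'a \<Rightarrow> nat \<Rightarrow> nat" where "inj_on f (topspace T)"
proof -
  obtain M d where M: "Metric_space M d" and T: "T = Metric_space.mtopology M d"
    using assms unfolding polish_def completely_metrizable_space_def by blast
  interpret Metric_space M d by (rule M)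
  obtain D where D: "countable D" "D \<subseteq> M" "mtopology closure_of D = M"
    using assms unfolding polish_def separable_space_def T by auto
  define f where "f = (\<lambda>x n. let (i, k) = prod_decode n in
      if d x (from_nat_into D i) < inverse (of_nat (Suc k)) then 1 else (0::nat))"
  have "inj_on f M"
  proof (rule inj_onI, rule ccontr)
    fix x y assume x: "x \<in> M" and y: "y \<in> M" and eq: "f x = f y" and ne: "x \<noteq> y"
    have "d x y > 0" using x y ne by simp
    then obtain k where k: "inverse (of_nat (Suc k)) < d x y / 2"
      using reals_Archimedean[of "d x y / 2"] by auto
    have "x \<in> mtopology closure_of D" using D x by simp
    then obtain z where z: "z \<in> D" "z \<in> mball x (inverse (of_nat (Suc k)))"
    proof -
      have "(0::real) < inverse (of_nat (Suc k))" by simp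
      with \<open>x \<in> mtopology closure_of D\<close> show thesis
        unfolding metric_closure_of using that by blast
    qed
    obtain i where i: "from_nat_into D i = z"
      using D(1) z(1) from_nat_into_surj by metis
    have "d x z < inverse (of_nat (Suc k))" using z by simp
    moreover have "f x (prod_encode (i, k)) = f y (prod_encode (i, k))" using eq by simp
    ultimately have "d y z < inverse (of_nat (Suc k))"
      unfolding f_def by (simp add: i split: if_splits)
    moreover have "d x y \<le> d x z + d y z"
      using x y z D by (metis commute subsetD triangle)
    ultimately show False
      using k \<open>d x z < _\<close> by linarith
  qed
  then show thesis using that T by auto
qed

lemma polish_copy:
  assumes "polish T"
  shows "\<exists>S :: (nat \<Rightarrow> nat) topology. polish S \<and> T homeomorphic_space S"
proof -
  obtain f :: "'a \<Rightarrow> nat \<Rightarrow> nat" where f: "inj_on f (topspace T)"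
    using polish_inj assms by blast
  define g where "g = inv_into (topspace T) f"
  define S where "S = pullback_topology (f ` topspace T) g T"
  have gf: "g (f x) = x" if "x \<in> topspace T" for x
    using f that by (simp add: g_def)
  have top: "topspace S = f ` topspace T"
    unfolding S_def topspace_pullback_topology using gf by auto
  have "continuous_map S T g"
    unfolding continuous_map_def
  proof (intro conjI allI impI)
    show "g \<in> topspace S \<rightarrow> topspace T" using top gf by auto
    fix U assume "openin T U"
    moreover have "{x \<in> topspace S. g x \<in> U} = g -` U \<inter> f ` topspace T"
      using top by auto
    ultimately show "openin S {x \<in> topspace S. g x \<in> U}"
      unfolding S_def openin_pullback_topology by blast
  qed
  moreover have "continuous_map T S f"
    unfolding continuous_map_def
  proof (intro conjI allI impI)
    show "f \<in> topspace T \<rightarrow> topspace S" using top by auto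
    fix V assume "openin S V"
    then obtain U where U: "openin T U" "V = g -` U \<inter> f ` topspace T"
      unfolding S_def openin_pullback_topology by blast
    have "f x \<in> V \<longleftrightarrow> x \<in> U" if "x \<in> topspace T" for x
      using that gf[OF that] unfolding U(2) by simp
    then have "{x \<in> topspace T. f x \<in> V} = U"
      using openin_subset[OF U(1)] by blast
    then show "openin T {x \<in> topspace T. f x \<in> V}" using U by simp
  qed
  ultimately have "homeomorphic_maps T S f g"
    unfolding homeomorphic_maps_def using gf top by auto
  then have "T homeomorphic_space S"
    unfolding homeomorphic_space_def by blast
  then show ?thesis using assms polish_homeomorphic by blast
qed

lemma in_pointclass_iff:
  assumes "pointclass \<Gamma>" "polish S" "homeomorphic_map T S h"
  shows "in_pointclass \<Gamma> T A \<longleftrightarrow> A \<subseteq> topspace T \<and> h ` A \<in> \<Gamma> S"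
proof
  assume "in_pointclass \<Gamma> T A"
  then obtain S' h' where A: "A \<subseteq> topspace T" and S': "polish S'" "homeomorphic_map T S' h'"
    "h' ` A \<in> \<Gamma> S'"
    unfolding in_pointclass_def by blast
  obtain g where g: "homeomorphic_maps T S h g"
    using assms(3) homeomorphic_map_maps by blast
  have "continuous_map S S' (h' \<circ> g)"
    using g S'(2) by (meson continuous_map_compose homeomorphic_imp_continuous_map homeomorphic_maps_def)
  then have "{x \<in> topspace S. (h' \<circ> g) x \<in> h' ` A} \<in> \<Gamma> S"
    using assms(1,2) S' unfolding pointclass_def by blast
  moreover have "{x \<in> topspace S. (h' \<circ> g) x \<in> h' ` A} = h ` A"
  proof -
    have inj: "inj_on h' (topspace T)"
      using S'(2) homeomorphic_imp_injective_map by blast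
    have gT: "g x \<in> topspace T" if "x \<in> topspace S" for x
      using g that unfolding homeomorphic_maps_def continuous_map_def by blast
    have hT: "h x \<in> topspace S" if "x \<in> topspace T" for x
      using g that unfolding homeomorphic_maps_def continuous_map_def by blast
    have hg: "h (g y) = y" if "y \<in> topspace S" for y
      using g that unfolding homeomorphic_maps_def by blast
    have gh: "g (h x) = x" if "x \<in> topspace T" for x
      using g that unfolding homeomorphic_maps_def by blast
    have "h' (g x) \<in> h' ` A \<longleftrightarrow> g x \<in> A" if "x \<in> topspace S" for x
      using inj gT[OF that] A by (simp add: inj_on_image_mem_iff)
    then show ?thesis
      using A hT hg gh by (auto simp: image_iff subset_iff) (metis hg)
  qed
  ultimately show "A \<subseteq> topspace T \<and> h ` A \<in> \<Gamma> S" using A by simp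
next
  assume "A \<subseteq> topspace T \<and> h ` A \<in> \<Gamma> S"
  then show "in_pointclass \<Gamma> T A"
    unfolding in_pointclass_def using assms by blast
qed

text \<open>
  Player I moves at even, player II at odd stages. A strategy is a function of the whole
  position, of which only the values at positions of its owner matter.
\<close>

definition follows_I :: "(nat list \<Rightarrow> nat) \<Rightarrow> (nat \<Rightarrow> nat) \<Rightarrow> bool" where
  "follows_I \<sigma> x \<longleftrightarrow> (\<forall>n. even n \<longrightarrow> x n = \<sigma> (map x [0..<n]))"

definition follows_II :: "(nat list \<Rightarrow> nat) \<Rightarrow> (nat \<Rightarrow> nat) \<Rightarrow> bool" where
  "follows_II \<tau> x \<longleftrightarrow> (\<forall>n. odd n \<longrightarrow> x n = \<tau> (map x [0..<n]))"

definition determined :: "(nat \<Rightarrow> nat) set \<Rightarrow> bool" where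
  "determined A \<longleftrightarrow>
     (\<exists>\<sigma>. \<forall>x. follows_I \<sigma> x \<longrightarrow> x \<in> A) \<or> (\<exists>\<tau>. \<forall>x. follows_II \<tau> x \<longrightarrow> x \<notin> A)"

definition pointclass_determinacy :: "point_family \<Rightarrow> bool" where
  "pointclass_determinacy \<Gamma> \<longleftrightarrow> (\<forall>A\<in>\<Gamma> baire. determined A)"

definition invariant_under :: "('a \<times> 'a) set \<Rightarrow> 'a set \<Rightarrow> bool" where
  "invariant_under E A \<longleftrightarrow> (\<forall>(x, y)\<in>E. x \<in> A \<longleftrightarrow> y \<in> A)"

definition equiv_determinacy :: "point_family \<Rightarrow> 'a topology \<Rightarrow> ('a \<times> 'a) set \<Rightarrow> bool" where
  "equiv_determinacy \<Gamma> T E \<longleftrightarrow>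
     (\<forall>\<pi> A. continuous_map baire T \<pi> \<longrightarrow> range \<pi> = topspace T \<longrightarrow>
        A \<subseteq> topspace T \<longrightarrow> invariant_under E A \<longrightarrow> in_pointclass \<Gamma> T A \<longrightarrow>
        determined (\<pi> -` A))"

definition occurs_in :: "bool list \<Rightarrow> (int \<Rightarrow> bool) \<Rightarrow> bool" where
  "occurs_in w x \<longleftrightarrow> (\<exists>i. \<forall>j<length w. x (i + int j) = w ! j)"

definition subshift_of_finite_type :: "(int \<Rightarrow> bool) set \<Rightarrow> bool" where
  "subshift_of_finite_type X \<longleftrightarrow> (\<exists>W. finite W \<and> X = {x. \<forall>w\<in>W. \<not> occurs_in w x})"

definition shift_equiv :: "(int \<Rightarrow> bool) set \<Rightarrow> ((int \<Rightarrow> bool) \<times> (int \<Rightarrow> bool)) set" where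
  "shift_equiv X = {(x, y). x \<in> X \<and> y \<in> X \<and> (\<exists>m. \<forall>k. y k = x (k + m))}"

end

theory Submission
  imports Defs
begin

text \<open>
  A point of \<open>X\<close> is a bi-infinite path in a finite graph of windows. If no vertex has two distinct
  loops of equal length, every path is eventually periodic in both directions and \<open>X\<close> is
  countable. Otherwise two distinct blocks \<open>u\<close>, \<open>v\<close> of the same length \<open>q\<close> can be concatenated
  freely inside \<open>X\<close>. A real \<open>y\<close> is coded continuously by a point \<open>\<dots>uuuv\<dots>\<close> whose further blocks
  spell out the graph of \<open>y\<close>. The first failure of \<open>q\<close>-periodicity marks a position that moves
  along with shifts, so that decoding relative to it is a shift-invariant map; it is of low Borel
  class. Hence every \<open>A\<close> in \<open>\<Gamma>\<close> is the preimage, under the coding map, of an invariant set in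
  \<open>\<Gamma>\<close>. The coding map is not onto, which is repaired by two preliminary moves: whenever player I
  declines to play the coding game, player II can win immediately, and if both decline, the rest of
  the play ranges over \<open>X\<close> through a continuous surjection of the Baire space.
\<close>

section \<open>Products of discrete spaces\<close>

abbreviation discrete_power :: "('i \<Rightarrow> 'v) topology" where
  "discrete_power \<equiv> product_topology (\<lambda>_. discrete_topology UNIV) UNIV"

definition cylinder :: "'i set \<Rightarrow> ('i \<Rightarrow> 'v) \<Rightarrow> ('i \<Rightarrow> 'v) set" where
  "cylinder F x = {y. \<forall>i\<in>F. y i = x i}"

lemma openin_cylinder:
  assumes "finite F"
  shows "openin discrete_power (cylinder F x)"
proof -
  have "cylinder F x = (\<Pi>\<^sub>E i\<in>UNIV. if i \<in> F then {x i} else UNIV)"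
    by (auto simp: cylinder_def PiE_iff split: if_splits)
  moreover have "finite {i. (if i \<in> F then {x i} else UNIV) \<noteq> UNIV}"
    by (rule finite_subset[OF _ assms]) auto
  ultimately show ?thesis
    by (simp add: openin_PiE_gen)
qed

lemma openin_discrete_power_iff:
  "openin discrete_power U \<longleftrightarrow> (\<forall>x\<in>U. \<exists>F. finite F \<and> cylinder F x \<subseteq> U)"
proof (intro iffI ballI)
  fix x assume "openin discrete_power U" "x \<in> U"
  then obtain V where V: "finite {i. V i \<noteq> UNIV}" "x \<in> Pi\<^sub>E UNIV V" "Pi\<^sub>E UNIV V \<subseteq> U"
    unfolding openin_product_topology_alt by auto
  have "y i \<in> V i" if "y \<in> cylinder {i. V i \<noteq> UNIV} x" for y i
    using that V(2) by (cases "V i = UNIV") (auto simp: cylinder_def)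
  then have "cylinder {i. V i \<noteq> UNIV} x \<subseteq> U"
    using V(3) by blast
  then show "\<exists>F. finite F \<and> cylinder F x \<subseteq> U"
    using V(1) by blast
next
  assume nbhd: "\<forall>x\<in>U. \<exists>F. finite F \<and> cylinder F x \<subseteq> U"
  have "\<exists>V. openin discrete_power V \<and> x \<in> V \<and> V \<subseteq> U" if x: "x \<in> U" for x
  proof -
    obtain F where "finite F" "cylinder F x \<subseteq> U"
      using nbhd x by blast
    moreover have "x \<in> cylinder F x"
      by (simp add: cylinder_def)
    ultimately show ?thesis
      using openin_cylinder by blast
  qed
  then show "openin discrete_power U"
    by (subst openin_subopen) blast
qed

lemma
  assumes "finite F" and "\<And>x y. (\<And>i. i \<in> F \<Longrightarrow> x i = y i) \<Longrightarrow> x \<in> U \<longleftrightarrow> y \<in> U"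
  shows openin_finite_dependence: "openin discrete_power U"
    and closedin_finite_dependence: "closedin discrete_power U"
proof -
  have "openin discrete_power V" if "V = U \<or> V = UNIV - U" for V
    unfolding openin_discrete_power_iff
  proof (intro ballI exI[of _ F] conjI assms(1) subsetI)
    fix x y assume "x \<in> V" "y \<in> cylinder F x"
    moreover from this have "y \<in> U \<longleftrightarrow> x \<in> U"
      by (intro assms(2)) (simp add: cylinder_def)
    ultimately show "y \<in> V"
      using that by blast
  qed
  then show "openin discrete_power U" "closedin discrete_power U"
    by (simp_all add: closedin_def)
qed

lemma continuous_map_finite_dependence:
  fixes f :: "('i \<Rightarrow> 'v) \<Rightarrow> 'j \<Rightarrow> 'w"
  assumes "\<And>j. \<exists>F. finite F \<and> (\<forall>x y. (\<forall>i\<in>F. x i = y i) \<longrightarrow> f x j = f y j)"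
  shows "continuous_map discrete_power discrete_power f"
  unfolding continuous_map_componentwise_UNIV
proof
  fix j
  obtain F where "finite F" and F: "\<forall>x y. (\<forall>i\<in>F. x i = y i) \<longrightarrow> f x j = f y j"
    using assms[of j] by blast
  have "openin discrete_power {x. f x j \<in> V}" for V
  proof (rule openin_finite_dependence[OF \<open>finite F\<close>])
    fix x y :: "'i \<Rightarrow> 'v" assume "\<And>i. i \<in> F \<Longrightarrow> x i = y i"
    then have "f x j = f y j"
      using F by blast
    then show "x \<in> {x. f x j \<in> V} \<longleftrightarrow> y \<in> {x. f x j \<in> V}"
      by simp
  qed
  then show "continuous_map discrete_power (discrete_topology UNIV) (\<lambda>x. f x j)"
    by (simp add: continuous_map_def)
qed

lemma second_countable_discrete_power:
  "second_countable (discrete_power :: ('i::countable \<Rightarrow> 'v::countable) topology)"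
proof -
  define graph_cylinder :: "('i \<times> 'v) set \<Rightarrow> ('i \<Rightarrow> 'v) set"
    where "graph_cylinder G = {y. \<forall>(i, v)\<in>G. y i = v}" for G
  define \<B> where "\<B> = graph_cylinder ` {G. finite G}"
  have "countable \<B>"
    by (simp add: \<B>_def countable_Collect_finite)
  moreover have "openin discrete_power V" if V: "V \<in> \<B>" for V
  proof -
    obtain G where G: "finite G" "V = graph_cylinder G"
      using V unfolding \<B>_def by blast
    then show ?thesis
      by (intro openin_finite_dependence[of "fst ` G"]) (force simp: graph_cylinder_def)+
  qed
  moreover have "\<exists>V\<in>\<B>. x \<in> V \<and> V \<subseteq> U" if U: "openin discrete_power U" "x \<in> U" for U x
  proof -
    obtain F where F: "finite F" "cylinder F x \<subseteq> U"
      using U openin_discrete_power_iff by blast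
    have "graph_cylinder ((\<lambda>i. (i, x i)) ` F) = cylinder F x"
      by (auto simp: graph_cylinder_def cylinder_def)
    then have "cylinder F x \<in> \<B>"
      unfolding \<B>_def using F(1) by blast
    moreover have "x \<in> cylinder F x"
      by (simp add: cylinder_def)
    ultimately show ?thesis
      using F(2) by blast
  qed
  ultimately show ?thesis
    unfolding second_countable_def by blast
qed

lemma completely_metrizable_discrete_power:
  "completely_metrizable_space (discrete_power :: ('i::countable \<Rightarrow> 'v) topology)"
  by (simp add: completely_metrizable_space_product_topology
      completely_metrizable_space_discrete_topology)

lemma polish_closed_discrete_power:
  fixes C :: "('i::countable \<Rightarrow> 'v::countable) set"
  assumes "closedin discrete_power C"
  shows "polish (subtopology discrete_power C)"
  unfolding polish_def
  by (intro conjI completely_metrizable_space_closedin[OF _ assms]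
      second_countable_imp_separable_space second_countable_subtopology
      completely_metrizable_discrete_power second_countable_discrete_power)

lemma topspace_baire [simp]: "topspace baire = UNIV"
  by (simp add: baire_def)

lemma topspace_cantorZ [simp]: "topspace cantorZ = UNIV"
  by (simp add: cantorZ_def)

lemma polish_baire: "polish baire"
  using polish_closed_discrete_power[OF closedin_topspace] by (simp add: baire_def)

lemma metrizable_cantorZ: "metrizable_space cantorZ"
  unfolding cantorZ_def
  by (rule completely_metrizable_imp_metrizable_space[OF completely_metrizable_discrete_power])

lemma openin_baire_iff: "openin baire U \<longleftrightarrow> (\<forall>x\<in>U. \<exists>n. cylinder {..<n} x \<subseteq> U)"
proof -
  have "(\<exists>F. finite F \<and> cylinder F x \<subseteq> U) \<longleftrightarrow> (\<exists>n. cylinder {..<n} x \<subseteq> U)" for x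
  proof
    assume "\<exists>F. finite F \<and> cylinder F x \<subseteq> U"
    then obtain F n where "cylinder F x \<subseteq> U" "F \<subseteq> {..<n}"
      using finite_nat_bounded by metis
    then have "cylinder {..<n} x \<subseteq> U"
      by (auto simp: cylinder_def)
    then show "\<exists>n. cylinder {..<n} x \<subseteq> U" ..
  qed blast
  then show ?thesis
    by (simp add: baire_def openin_discrete_power_iff)
qed

section \<open>Finite Borel levels\<close>

lemma Sigma0_Suc:
  assumes "n \<ge> 1"
  shows "Sigma0 T (Suc n) = {\<Union>k::nat. topspace T - B k | B. \<forall>k. B k \<in> Sigma0 T n}"
  using assms by (cases n) auto

lemma Compl_in_Sigma0_Suc:
  assumes "n \<ge> 1" "B \<in> Sigma0 T n"
  shows "topspace T - B \<in> Sigma0 T (Suc n)"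
  unfolding Sigma0_Suc[OF assms(1)] mem_Collect_eq
  by (rule exI[of _ "\<lambda>_. B"]) (use assms(2) in simp)

lemma
  assumes "n \<ge> 1"
  shows empty_in_Sigma0: "{} \<in> Sigma0 T n" and topspace_in_Sigma0: "topspace T \<in> Sigma0 T n"
proof -
  have "{} \<in> Sigma0 T n \<and> topspace T \<in> Sigma0 T n"
    using assms
  proof (induction n rule: dec_induct)
    case (step n)
    then show ?case
      using Compl_in_Sigma0_Suc[of n "{}" T] Compl_in_Sigma0_Suc[of n "topspace T" T] by simp
  qed simp
  then show "{} \<in> Sigma0 T n" "topspace T \<in> Sigma0 T n" by auto
qed

lemma Sigma0_UN_nat:
  assumes "n \<ge> 1" "\<And>k::nat. B k \<in> Sigma0 T n"
  shows "(\<Union>k. B k) \<in> Sigma0 T n"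
proof (cases "n = 1")
  case True
  then show ?thesis using assms(2) by auto
next
  case False
  then obtain m where m: "n = Suc m" "m \<ge> 1" using assms(1) by (cases n) auto
  have "\<forall>k. \<exists>C. B k = (\<Union>j::nat. topspace T - C j) \<and> (\<forall>j. C j \<in> Sigma0 T m)"
    using assms(2) unfolding m Sigma0_Suc[OF m(2)] by blast
  then obtain C where C: "\<And>k. B k = (\<Union>j::nat. topspace T - C k j)" "\<And>k j. C k j \<in> Sigma0 T m"
    by metis
  have "(\<Union>k. B k) = (\<Union>(k, j). topspace T - C k j)"
    unfolding C(1) by blast
  also have "\<dots> = (\<Union>i. case prod_decode i of (k, j) \<Rightarrow> topspace T - C k j)"
    using surj_prod_decode by (metis image_image)
  also have "\<dots> = (\<Union>i. topspace T - (case prod_decode i of (k, j) \<Rightarrow> C k j))"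
    by (simp add: case_prod_beta)
  finally show ?thesis
    unfolding m Sigma0_Suc[OF m(2)] using C(2) by (auto simp: case_prod_beta)
qed

lemma Sigma0_UN:
  assumes "n \<ge> 1" "countable I" "\<And>i. i \<in> I \<Longrightarrow> B i \<in> Sigma0 T n"
  shows "(\<Union>i\<in>I. B i) \<in> Sigma0 T n"
proof (cases "I = {}")
  case True
  then show ?thesis by (simp add: empty_in_Sigma0[OF assms(1)])
next
  case False
  then have "(\<Union>i\<in>I. B i) = (\<Union>k. B (from_nat_into I k))"
    using range_from_nat_into[OF False assms(2)] by (metis image_image)
  also have "\<dots> \<in> Sigma0 T n"
    using assms(3) from_nat_into[OF False] by (intro Sigma0_UN_nat[OF assms(1)]) simp
  finally show ?thesis .
qed

lemma Sigma0_Un: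
  assumes "n \<ge> 1" "B \<in> Sigma0 T n" "C \<in> Sigma0 T n"
  shows "B \<union> C \<in> Sigma0 T n"
  using Sigma0_UN[OF assms(1), of "{B, C}" id T] assms(2,3) by auto

lemma Sigma0_Int:
  assumes "n \<ge> 1" "B \<in> Sigma0 T n" "C \<in> Sigma0 T n"
  shows "B \<inter> C \<in> Sigma0 T n"
proof (cases "n = 1")
  case True
  then show ?thesis using assms by auto
next
  case False
  then obtain m where m: "n = Suc m" "m \<ge> 1" using assms(1) by (cases n) auto
  obtain D where D: "B = (\<Union>k::nat. topspace T - D k)" "\<And>k. D k \<in> Sigma0 T m"
    using assms(2) unfolding m Sigma0_Suc[OF m(2)] by blast
  obtain E where E: "C = (\<Union>k::nat. topspace T - E k)" "\<And>k. E k \<in> Sigma0 T m"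
    using assms(3) unfolding m Sigma0_Suc[OF m(2)] by blast
  have "B \<inter> C = (\<Union>(j, k)\<in>UNIV. topspace T - (D j \<union> E k))"
    unfolding D(1) E(1) by auto
  also have "\<dots> \<in> Sigma0 T n"
    using D(2) E(2) m by (intro Sigma0_UN) (auto intro!: Compl_in_Sigma0_Suc Sigma0_Un)
  finally show ?thesis .
qed

lemma Sigma0_Ball_finite:
  assumes "n \<ge> 1" "finite I" "\<And>i. i \<in> I \<Longrightarrow> {x \<in> topspace T. P i x} \<in> Sigma0 T n"
  shows "{x \<in> topspace T. \<forall>i\<in>I. P i x} \<in> Sigma0 T n"
  using assms(2,3)
proof (induction I rule: finite_induct)
  case empty
  then show ?case by (simp add: topspace_in_Sigma0[OF assms(1)])
next
  case (insert i I)
  then have "{x \<in> topspace T. P i x} \<inter> {x \<in> topspace T. \<forall>i\<in>I. P i x} \<in> Sigma0 T n"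
    by (intro Sigma0_Int[OF assms(1)]) auto
  also have "{x \<in> topspace T. P i x} \<inter> {x \<in> topspace T. \<forall>i\<in>I. P i x} =
      {x \<in> topspace T. \<forall>i\<in>insert i I. P i x}"
    by auto
  finally show ?case .
qed

lemma closedin_imp_Sigma0_2:
  assumes "closedin T C"
  shows "C \<in> Sigma0 T 2"
proof -
  have "topspace T - (topspace T - C) \<in> Sigma0 T (Suc 1)"
    using assms by (intro Compl_in_Sigma0_Suc) (auto simp: closedin_def)
  then show ?thesis
    using closedin_subset[OF assms] by (simp add: double_diff numeral_2_eq_2)
qed

lemma Sigma0_mono_Suc:
  assumes "metrizable_space T" "n \<ge> 1"
  shows "Sigma0 T n \<subseteq> Sigma0 T (Suc n)"
  using assms(2)
proof (induction n rule: dec_induct)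
  case base
  show ?case
  proof
    fix U assume "U \<in> Sigma0 T 1"
    then have "fsigma_in T U" using open_imp_fsigma_in[OF assms(1)] by simp
    then obtain \<C> where \<C>: "countable \<C>" "\<And>C. C \<in> \<C> \<Longrightarrow> closedin T C" "\<Union>\<C> = U"
      unfolding fsigma_in_def union_of_def by auto
    have "(\<Union>C\<in>\<C>. C) \<in> Sigma0 T 2"
      using \<C>(1,2) by (intro Sigma0_UN closedin_imp_Sigma0_2) auto
    then show "U \<in> Sigma0 T (Suc 1)"
      by (simp only: image_ident \<C>(3) Suc_1)
  qed
next
  case (step n)
  show ?case
  proof
    fix B assume "B \<in> Sigma0 T (Suc n)"
    then obtain C where C: "B = (\<Union>k::nat. topspace T - C k)" "\<And>k. C k \<in> Sigma0 T n"
      unfolding Sigma0_Suc[OF step.hyps(1)] by blast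
    have "topspace T - C k \<in> Sigma0 T (Suc (Suc n))" for k
      using step.IH C(2) by (intro Compl_in_Sigma0_Suc) auto
    then show "B \<in> Sigma0 T (Suc (Suc n))"
      unfolding C(1) by (rule Sigma0_UN_nat[rotated]) simp
  qed
qed

lemma Sigma0_mono:
  assumes "metrizable_space T" "1 \<le> m" "m \<le> n"
  shows "Sigma0 T m \<subseteq> Sigma0 T n"
  using assms(3)
proof (induction n rule: dec_induct)
  case (step n)
  then show ?case using Sigma0_mono_Suc[OF assms(1), of n] assms(2) by simp
qed simp

lemma Sigma0_subset_topspace: "B \<in> Sigma0 T n \<Longrightarrow> B \<subseteq> topspace T"
  by (cases "(T, n)" rule: Sigma0.cases) (auto dest: openin_subset)

lemma Sigma0_subset_Delta0_Suc:
  assumes "metrizable_space T" "n \<ge> 1"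
  shows "Sigma0 T n \<subseteq> Delta0 T (Suc n)"
proof
  fix B assume B: "B \<in> Sigma0 T n"
  have "B = topspace T - (topspace T - B)"
    using B Sigma0_subset_topspace by blast
  then show "B \<in> Delta0 T (Suc n)"
    unfolding Delta0_def Pi0_def
    using B Compl_in_Sigma0_Suc[OF assms(2) B] Sigma0_mono_Suc[OF assms] by blast
qed

lemma Delta0_mono:
  assumes "metrizable_space T" "1 \<le> m" "m \<le> n"
  shows "Delta0 T m \<subseteq> Delta0 T n"
  using Sigma0_mono[OF assms] by (auto simp: Delta0_def Pi0_def)

text \<open>If no \<open>P m x\<close> holds, \<^term>\<open>LEAST m. P m x\<close> is the fixed number \<^term>\<open>LEAST m::nat. False\<close>.\<close>

lemma Sigma0_Least:
  fixes P :: "nat \<Rightarrow> 'a \<Rightarrow> bool"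
  assumes "metrizable_space T" "n \<ge> 1" and P: "\<And>m. {x \<in> topspace T. P m x} \<in> Sigma0 T n"
  shows "{x \<in> topspace T. (LEAST m. P m x) = k} \<in> Sigma0 T (Suc n)"
proof -
  define S where "S m = {x \<in> topspace T. P m x}" for m
  have S: "S m \<in> Sigma0 T n" for m
    unfolding S_def by (rule P)
  have Compl_UN: "topspace T - (\<Union>m\<in>M. S m) \<in> Sigma0 T (Suc n)" for M
    using assms(2) S by (intro Compl_in_Sigma0_Suc Sigma0_UN) auto
  have "{x \<in> topspace T. (LEAST m. P m x) = k} =
      (S k \<inter> (topspace T - (\<Union>m<k. S m))) \<union>
      (if k = (LEAST m. False) then topspace T - (\<Union>m. S m) else {})" (is "?L = ?R")
  proof (intro set_eqI)
    fix x
    show "x \<in> ?L \<longleftrightarrow> x \<in> ?R"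
    proof (cases "\<exists>m. P m x")
      case True
      then have "(LEAST m. P m x) = k \<longleftrightarrow> P k x \<and> (\<forall>m<k. \<not> P m x)"
        by (metis LeastI_ex not_less_Least linorder_neqE_nat)
      then show ?thesis
        using True by (auto simp: S_def)
    next
      case False
      then show ?thesis
        by (auto simp: S_def)
    qed
  qed
  also have "\<dots> \<in> Sigma0 T (Suc n)"
    using Compl_UN[of UNIV] Sigma0_mono_Suc[OF assms(1,2)] S
    by (intro Sigma0_Un Sigma0_Int Compl_UN) (auto intro: empty_in_Sigma0)
  finally show ?thesis .
qed

lemma Sigma0_preimage:
  assumes "continuous_map S T f" "B \<in> Sigma0 T n"
  shows "{x \<in> topspace S. f x \<in> B} \<in> Sigma0 S n"
  using assms
proof (induction T n arbitrary: B rule: Sigma0.induct)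
  case (2 T)
  then show ?case by (auto intro: openin_continuous_map_preimage)
next
  case (3 T n)
  then obtain C where C: "B = (\<Union>k::nat. topspace T - C k)" "\<And>k. C k \<in> Sigma0 T (Suc n)"
    by auto
  have "{x \<in> topspace S. f x \<in> B} = (\<Union>k::nat. topspace S - {x \<in> topspace S. f x \<in> C k})"
    using 3(2) C(1) by (auto simp: continuous_map_def Pi_def)
  moreover have "{x \<in> topspace S. f x \<in> C k} \<in> Sigma0 S (Suc n)" for k
    using 3 C(2) by blast
  ultimately show ?case by auto
qed simp

lemma Delta0_preimage:
  assumes "continuous_map S T f" "B \<in> Delta0 T n"
  shows "{x \<in> topspace S. f x \<in> B} \<in> Delta0 S n"
proof -
  obtain C where C: "B = topspace T - C" "C \<in> Sigma0 T n" and B: "B \<in> Sigma0 T n"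
    using assms(2) by (auto simp: Delta0_def Pi0_def)
  have "{x \<in> topspace S. f x \<in> B} = topspace S - {x \<in> topspace S. f x \<in> C}"
    using assms(1) by (auto simp: C(1) continuous_map_def)
  then show ?thesis
    unfolding Delta0_def Pi0_def
    using Sigma0_preimage[OF assms(1) B] Sigma0_preimage[OF assms(1) C(2)] by blast
qed

lemma Delta0_measurable_compose_continuous:
  assumes "continuous_map S T h" "Delta0_measurable n T R f"
  shows "Delta0_measurable n S R (f \<circ> h)"
  unfolding Delta0_measurable_def
proof (intro conjI allI impI)
  have hT: "h x \<in> topspace T" if "x \<in> topspace S" for x
    using assms(1) that by (auto simp: continuous_map_def)
  then show "f \<circ> h \<in> topspace S \<rightarrow> topspace R"
    using assms(2) unfolding Delta0_measurable_def by auto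
  fix U assume "openin R U"
  then have "{x \<in> topspace T. f x \<in> U} \<in> Delta0 T n"
    using assms(2) unfolding Delta0_measurable_def by blast
  then have "{x \<in> topspace S. h x \<in> {x \<in> topspace T. f x \<in> U}} \<in> Delta0 S n"
    by (rule Delta0_preimage[OF assms(1)])
  also have "{x \<in> topspace S. h x \<in> {x \<in> topspace T. f x \<in> U}} = {x \<in> topspace S. (f \<circ> h) x \<in> U}"
    using hT by auto
  finally show "{x \<in> topspace S. (f \<circ> h) x \<in> U} \<in> Delta0 S n" .
qed

lemma Delta0_measurable_mono:
  assumes "metrizable_space S" "1 \<le> m" "m \<le> n" "Delta0_measurable m S T f"
  shows "Delta0_measurable n S T f"
  using assms(4) Delta0_mono[OF assms(1-3)] unfolding Delta0_measurable_def by blast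

lemma Sigma0_vimage_openin_baire:
  assumes n: "n \<ge> 1" and f: "\<And>k m. {x \<in> topspace T. f x k = m} \<in> Sigma0 T n"
    and U: "openin baire U"
  shows "{x \<in> topspace T. f x \<in> U} \<in> Sigma0 T n"
proof -
  define stem :: "nat list \<Rightarrow> nat \<Rightarrow> nat" where "stem l k = l ! k" for l k
  define L where "L = {l. cylinder {..<length l} (stem l) \<subseteq> U}"
  have "y \<in> U \<longleftrightarrow> (\<exists>l\<in>L. y \<in> cylinder {..<length l} (stem l))" for y
  proof
    assume "y \<in> U"
    then obtain k where k: "cylinder {..<k} y \<subseteq> U"
      using U openin_baire_iff by blast
    define l where "l = map y [0..<k]"
    have "cylinder {..<length l} (stem l) = cylinder {..<k} y"
      by (simp add: cylinder_def l_def stem_def)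
    moreover have "y \<in> cylinder {..<k} y"
      by (simp add: cylinder_def)
    ultimately show "\<exists>l\<in>L. y \<in> cylinder {..<length l} (stem l)"
      unfolding L_def using k by blast
  qed (auto simp: L_def)
  then have "{x \<in> topspace T. f x \<in> U} =
      (\<Union>l\<in>L. {x \<in> topspace T. \<forall>k\<in>{..<length l}. f x k = stem l k})"
    by (auto simp: cylinder_def)
  also have "\<dots> \<in> Sigma0 T n"
    using n f by (intro Sigma0_UN Sigma0_Ball_finite) auto
  finally show ?thesis .
qed

lemma Delta0_measurable_baireI:
  assumes "metrizable_space T" "n \<ge> 1" "\<And>k m. {x \<in> topspace T. f x k = m} \<in> Sigma0 T n"
  shows "Delta0_measurable (Suc n) T baire f"
  unfolding Delta0_measurable_def
  using Sigma0_subset_Delta0_Suc[OF assms(1,2)] Sigma0_vimage_openin_baire[OF assms(2,3)] by auto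

lemma in_pointclass_Delta0_vimage:
  assumes \<Gamma>: "reasonable \<Gamma>" and T: "polish T" and f: "Delta0_measurable 6 T baire f"
    and A: "A \<in> \<Gamma> baire"
  shows "in_pointclass \<Gamma> T {x \<in> topspace T. f x \<in> A}"
proof -
  obtain S :: "(nat \<Rightarrow> nat) topology" and h h'
    where S: "polish S" and h: "homeomorphic_maps T S h h'"
    using polish_copy[OF T] unfolding homeomorphic_space_def by blast
  have "Delta0_measurable 6 S baire (f \<circ> h')"
    using h f by (intro Delta0_measurable_compose_continuous) (auto simp: homeomorphic_maps_def)
  then have "{z \<in> topspace S. (f \<circ> h') z \<in> A} \<in> \<Gamma> S"
    using \<Gamma> A S polish_baire unfolding reasonable_def by blast
  also have "{z \<in> topspace S. (f \<circ> h') z \<in> A} = h ` {x \<in> topspace T. f x \<in> A}"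
  proof -
    have "h x \<in> topspace S" "h' (h x) = x" if "x \<in> topspace T" for x
      using h that by (auto simp: homeomorphic_maps_def continuous_map_def)
    moreover have "h' z \<in> topspace T" "h (h' z) = z" if "z \<in> topspace S" for z
      using h that by (auto simp: homeomorphic_maps_def continuous_map_def)
    ultimately show ?thesis
      by (auto simp: image_iff) metis
  qed
  finally show ?thesis
    unfolding in_pointclass_def using S h homeomorphic_map_maps by blast
qed

section \<open>Polish spaces as continuous images of the Baire space\<close>

text \<open>Refusing steps that are too long makes the approximants converge for every \<open>y\<close>.\<close>

primrec approximant :: "('a \<Rightarrow> 'a \<Rightarrow> real) \<Rightarrow> (nat \<Rightarrow> 'a) \<Rightarrow> (nat \<Rightarrow> nat) \<Rightarrow> nat \<Rightarrow> 'a" where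
  "approximant d e y 0 = e (y 0)"
| "approximant d e y (Suc n) =
     (if d (approximant d e y n) (e (y (Suc n))) < (1/2) ^ n then e (y (Suc n))
      else approximant d e y n)"

lemma approximant_cong:
  assumes "\<And>k. k \<le> n \<Longrightarrow> y k = z k"
  shows "approximant d e y n = approximant d e z n"
  using assms by (induction n) auto

lemma approximant_in:
  assumes "range e \<subseteq> M"
  shows "approximant d e y n \<in> M"
  using assms by (induction n) auto

lemma (in Metric_space) dist_approximant_Suc:
  assumes "range e \<subseteq> M"
  shows "d (approximant d e y n) (approximant d e y (Suc n)) \<le> (1/2) ^ n"
  using approximant_in[OF assms, of d y n] by simp

lemma (in Metric_space) approximant_eq:
  assumes e: "range e \<subseteq> M" and x: "x \<in> M" and y: "\<And>n. d x (e (y n)) < (1/2) ^ (n + 2)"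
  shows "approximant d e y n = e (y n)"
proof (induction n)
  case (Suc n)
  have "d (e (y n)) (e (y (Suc n))) \<le> d x (e (y n)) + d x (e (y (Suc n)))"
    using e x by (metis commute range_subsetD triangle)
  also have "\<dots> < (1/2) ^ (n + 2) + (1/2) ^ (Suc n + 2)"
    using y by (intro add_strict_mono)
  also have "\<dots> \<le> (1/2) ^ n"
    by simp
  finally show ?case
    by (simp add: Suc)
qed simp

lemma (in Metric_space) dist_le_geometric_sum:
  assumes "range s \<subseteq> M" and "\<And>n. d (s n) (s (Suc n)) \<le> (1/2) ^ n" and "m \<le> n"
  shows "d (s m) (s n) \<le> 2 * (1/2) ^ m"
proof -
  have "d (s m) (s n) \<le> 2 * (1/2) ^ m - 2 * (1/2) ^ n"
    using \<open>m \<le> n\<close>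
  proof (induction n rule: dec_induct)
    case base
    then show ?case using assms(1) by (simp add: range_subsetD)
  next
    case (step n)
    have "d (s m) (s (Suc n)) \<le> d (s m) (s n) + d (s n) (s (Suc n))"
      using assms(1) by (intro triangle) auto
    then show ?case
      using step.IH assms(2)[of n] by simp
  qed
  moreover have "(0::real) \<le> 2 * (1/2) ^ n"
    by simp
  ultimately show ?thesis
    by linarith
qed

lemma (in Metric_space) mcomplete_geometric_limit:
  assumes "mcomplete" and s: "range s \<subseteq> M" and step: "\<And>n. d (s n) (s (Suc n)) \<le> (1/2) ^ n"
  obtains l where "l \<in> M" "\<And>n. d (s n) l \<le> 2 * (1/2) ^ n"
proof -
  have "MCauchy s"
    unfolding MCauchy_def
  proof (intro conjI s allI impI)
    fix \<epsilon> :: real assume "\<epsilon> > 0"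
    then obtain N where N: "(1/2) ^ N < \<epsilon> / 4"
      using real_arch_pow_inv[of "\<epsilon> / 4" "1/2"] by auto
    have "d (s n) (s n') < \<epsilon>" if "N \<le> n" "N \<le> n'" for n n'
    proof -
      have "d (s n) (s n') \<le> d (s N) (s n) + d (s N) (s n')"
        using s by (metis commute range_subsetD triangle)
      also have "\<dots> < \<epsilon>"
        using dist_le_geometric_sum[OF s step that(1)] dist_le_geometric_sum[OF s step that(2)] N
        by simp
      finally show ?thesis .
    qed
    then show "\<exists>N. \<forall>n n'. N \<le> n \<longrightarrow> N \<le> n' \<longrightarrow> d (s n) (s n') < \<epsilon>"
      by blast
  qed
  then obtain l where l: "limitin mtopology s l sequentially"
    using \<open>mcomplete\<close> unfolding mcomplete_def by blast
  have "l \<in> mcball (s n) (2 * (1/2) ^ n)" for n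
  proof (rule limitin_closedin[OF l closedin_mcball])
    show "\<forall>\<^sub>F m in sequentially. s m \<in> mcball (s n) (2 * (1/2) ^ n)"
      using eventually_ge_at_top[of n]
      by eventually_elim (use s dist_le_geometric_sum[OF s step] in auto)
  qed simp
  then show thesis
    using that[OF limitin_mspace[OF l]] by simp
qed

lemma (in Metric_space) continuous_map_approximant_limit:
  assumes e: "range e \<subseteq> M" and \<psi>: "\<And>y. \<psi> y \<in> M"
    and dist: "\<And>y n. d (approximant d e y n) (\<psi> y) \<le> 2 * (1/2) ^ n"
  shows "continuous_map baire mtopology \<psi>"
proof -
  have "openin baire {y. \<psi> y \<in> U}" if U: "openin mtopology U" for U
    unfolding openin_baire_iff
  proof
    fix y assume "y \<in> {y. \<psi> y \<in> U}"
    then obtain \<epsilon> where \<epsilon>: "\<epsilon> > 0" "mball (\<psi> y) \<epsilon> \<subseteq> U"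
      using U openin_mtopology by auto
    obtain n where n: "(1/2) ^ n < \<epsilon> / 4"
      using real_arch_pow_inv[of "\<epsilon> / 4" "1/2"] \<epsilon>(1) by auto
    have "\<psi> z \<in> U" if "z \<in> cylinder {..<Suc n} y" for z
    proof -
      have "approximant d e y n = approximant d e z n"
        using that by (intro approximant_cong) (simp add: cylinder_def)
      then have "d (\<psi> y) (\<psi> z) \<le> d (approximant d e y n) (\<psi> y) + d (approximant d e z n) (\<psi> z)"
        using triangle'[of "\<psi> y" "approximant d e y n" "\<psi> z"] \<psi> approximant_in[OF e]
        by (simp add: commute)
      then have "d (\<psi> y) (\<psi> z) < \<epsilon>"
        using dist[of y n] dist[of z n] n by linarith
      then show ?thesis
        using \<epsilon>(2) \<psi> by auto
    qed
    then show "\<exists>n. cylinder {..<n} y \<subseteq> {y. \<psi> y \<in> U}"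
      by blast
  qed
  then show ?thesis
    using \<psi> by (simp add: continuous_map_def)
qed

lemma (in Metric_space) dense_sequence_dist_less:
  assumes "mtopology closure_of range e = M" "x \<in> M" "\<epsilon> > 0"
  shows "\<exists>k. d x (e k) < \<epsilon>"
proof -
  have "x \<in> mtopology closure_of range e"
    using assms(1,2) by simp
  then have "\<exists>z\<in>range e. z \<in> mball x \<epsilon>"
    using \<open>\<epsilon> > 0\<close> unfolding metric_closure_of by blast
  then show ?thesis
    by auto
qed

lemma (in Metric_space) range_approximant_limit:
  assumes e: "range e \<subseteq> M" "mtopology closure_of range e = M" and \<psi>: "\<And>y. \<psi> y \<in> M"
    and dist: "\<And>y n. d (approximant d e y n) (\<psi> y) \<le> 2 * (1/2) ^ n"
  shows "range \<psi> = M"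
proof (intro equalityI subsetI)
  fix x assume x: "x \<in> M"
  have "\<exists>k. d x (e k) < (1/2) ^ (n + 2)" for n
    by (rule dense_sequence_dist_less[OF e(2) x]) simp
  then obtain y where y: "\<And>n. d x (e (y n)) < (1/2) ^ (n + 2)"
    by metis
  have "d x (\<psi> y) < \<epsilon>" if \<epsilon>: "\<epsilon> > 0" for \<epsilon>
  proof -
    obtain n where n: "(1/2) ^ n < \<epsilon> / 4"
      using real_arch_pow_inv[of "\<epsilon> / 4" "1/2"] \<epsilon> by auto
    have "d x (\<psi> y) \<le> d x (e (y n)) + d (e (y n)) (\<psi> y)"
      using x \<psi> e(1) by (intro triangle) auto
    also have "d (e (y n)) (\<psi> y) \<le> 2 * (1/2) ^ n"
      using dist[of y n] by (simp add: approximant_eq[OF e(1) x y])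
    finally have "d x (\<psi> y) \<le> d x (e (y n)) + 2 * (1/2) ^ n"
      by simp
    moreover have "4 * d x (e (y n)) < (1/2) ^ n"
      using y[of n] by simp
    ultimately show ?thesis
      using n nonneg[of x "e (y n)"] by linarith
  qed
  then have "d x (\<psi> y) = 0"
    using nonneg[of x "\<psi> y"] by (metis less_irrefl linorder_not_less order_antisym)
  then show "x \<in> range \<psi>"
    using x \<psi> by simp
qed (use \<psi> in auto)

lemma polish_continuous_image_baire:
  assumes "polish T" "topspace T \<noteq> {}"
  obtains \<psi> where "continuous_map baire T \<psi>" "range \<psi> = topspace T"
proof -
  obtain M d where "Metric_space M d" and complete: "Metric_space.mcomplete M d"
    and T: "T = Metric_space.mtopology M d"
    using assms(1) unfolding polish_def completely_metrizable_space_def by blast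
  interpret Metric_space M d by fact
  obtain D where D: "countable D" "D \<subseteq> M" "mtopology closure_of D = M"
    using assms(1) unfolding polish_def separable_space_def T by auto
  then have "D \<noteq> {}"
    using assms(2) by (auto simp: T)
  then obtain e :: "nat \<Rightarrow> 'a" where "D = range e"
    using uncountable_def D(1) by blast
  then have e: "range e \<subseteq> M" "mtopology closure_of range e = M"
    using D by auto
  have "\<exists>l\<in>M. \<forall>n. d (approximant d e y n) l \<le> 2 * (1/2) ^ n" for y
  proof -
    have "range (approximant d e y) \<subseteq> M"
      using approximant_in[OF e(1)] by blast
    then show ?thesis
      using mcomplete_geometric_limit[OF complete, of "approximant d e y"]
        dist_approximant_Suc[OF e(1)] by metis
  qed
  then obtain \<psi> where \<psi>: "\<And>y. \<psi> y \<in> M" "\<And>y n. d (approximant d e y n) (\<psi> y) \<le> 2 * (1/2) ^ n"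
    by metis
  show thesis
    using that continuous_map_approximant_limit[OF e(1) \<psi>] range_approximant_limit[OF e \<psi>]
    by (simp add: T)
qed

section \<open>Infinite games\<close>

lemma ex_history_recursion: "\<exists>x. \<forall>n. x n = F (map x [0..<n])"
proof -
  define h where "h = rec_nat [] (\<lambda>_ p. p @ [F p])"
  have h: "h 0 = []" "\<And>n. h (Suc n) = h n @ [F (h n)]"
    by (simp_all add: h_def)
  have "map (\<lambda>n. F (h n)) [0..<n] = h n" for n
    by (induction n) (simp_all add: h)
  then show ?thesis
    by (intro exI[of _ "\<lambda>n. F (h n)"]) simp
qed

lemma ex_follows_I: "\<exists>x. follows_I \<sigma> x"
  using ex_history_recursion[of \<sigma>] unfolding follows_I_def by blast

lemma map_case_nat_upt_Suc: "map (case_nat a y) [0..<Suc n] = a # map y [0..<n]"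
  by (simp only: map_upt_Suc nat.case)

lemma all_nat_iff: "(\<forall>n. P n) \<longleftrightarrow> P 0 \<and> (\<forall>n. P (Suc n))"
  by (metis nat.exhaust)

lemma follows_I_case_nat:
  "follows_I \<sigma> (case_nat a y) \<longleftrightarrow> a = \<sigma> [] \<and> follows_II (\<lambda>p. \<sigma> (a # p)) y"
  unfolding follows_I_def follows_II_def
  by (subst all_nat_iff) (simp add: map_case_nat_upt_Suc del: upt_Suc)

lemma follows_II_case_nat:
  "follows_II \<tau> (case_nat a y) \<longleftrightarrow> follows_I (\<lambda>p. \<tau> (a # p)) y"
  unfolding follows_I_def follows_II_def
  by (subst all_nat_iff) (simp add: map_case_nat_upt_Suc del: upt_Suc)

lemma determined_after_two_moves:
  assumes "determined A'"
    and play: "\<And>b y. case_nat 0 (case_nat b y) \<in> A' \<longleftrightarrow> y \<in> A"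
    and decline: "\<And>a y. a \<noteq> 0 \<Longrightarrow> case_nat a (case_nat 0 y) \<notin> A'"
  shows "determined A"
proof -
  consider (I) \<sigma> where "\<And>x. follows_I \<sigma> x \<Longrightarrow> x \<in> A'" | (II) \<tau> where "\<And>x. follows_II \<tau> x \<Longrightarrow> x \<notin> A'"
    using assms(1) unfolding determined_def by blast
  then show ?thesis
  proof cases
    case I
    have reply_0: "case_nat (\<sigma> []) (case_nat 0 y) \<in> A'"
      if "follows_I (\<lambda>p. \<sigma> (\<sigma> [] # 0 # p)) y" for y
      using that by (intro I) (simp add: follows_I_case_nat follows_II_case_nat)
    obtain y where "follows_I (\<lambda>p. \<sigma> (\<sigma> [] # 0 # p)) y"
      using ex_follows_I by blast
    then have "\<sigma> [] = 0"
      using reply_0 decline by blast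
    then have "\<forall>y. follows_I (\<lambda>p. \<sigma> (0 # 0 # p)) y \<longrightarrow> y \<in> A"
      using reply_0 play by simp
    then show ?thesis
      unfolding determined_def by blast
  next
    case II
    have "y \<notin> A" if "follows_II (\<lambda>p. \<tau> (0 # \<tau> [0] # p)) y" for y
      using II[of "case_nat 0 (case_nat (\<tau> [0]) y)"] that play
      by (simp add: follows_I_case_nat follows_II_case_nat)
    then show ?thesis
      unfolding determined_def by blast
  qed
qed

definition with_prelude ::
    "((nat \<Rightarrow> nat) \<Rightarrow> 'a) \<Rightarrow> 'a \<Rightarrow> ((nat \<Rightarrow> nat) \<Rightarrow> 'a) \<Rightarrow> (nat \<Rightarrow> nat) \<Rightarrow> 'a" where
  "with_prelude \<phi> z \<psi> x =
     (if x 0 = 0 then \<phi> else if x (Suc 0) = 0 then \<lambda>_. z else \<psi>) (\<lambda>n. x (Suc (Suc n)))"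

lemma with_prelude_case_nat:
  "with_prelude \<phi> z \<psi> (case_nat a (case_nat b y)) =
     (if a = 0 then \<phi> y else if b = 0 then z else \<psi> y)"
  by (simp add: with_prelude_def)

lemma continuous_map_baire_first_move:
  assumes "\<And>a. continuous_map baire T (f a)"
  shows "continuous_map baire T (\<lambda>x. f (x 0) (\<lambda>n. x (Suc n)))"
proof -
  have "openin baire {x. f (x 0) (\<lambda>n. x (Suc n)) \<in> U}" if U: "openin T U" for U
    unfolding openin_baire_iff
  proof
    fix x assume x: "x \<in> {x. f (x 0) (\<lambda>n. x (Suc n)) \<in> U}"
    have "openin baire {y. f (x 0) y \<in> U}"
      using assms[of "x 0"] U by (simp add: continuous_map_def)
    then obtain n where n: "cylinder {..<n} (\<lambda>n. x (Suc n)) \<subseteq> {y. f (x 0) y \<in> U}"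
      using x unfolding openin_baire_iff by auto
    have "z \<in> {x. f (x 0) (\<lambda>n. x (Suc n)) \<in> U}" if z: "z \<in> cylinder {..<Suc n} x" for z
    proof -
      have "z 0 = x 0" "(\<lambda>n. z (Suc n)) \<in> cylinder {..<n} (\<lambda>n. x (Suc n))"
        using z by (simp_all add: cylinder_def)
      then show ?thesis
        using n by auto
    qed
    then show "\<exists>n. cylinder {..<n} x \<subseteq> {x. f (x 0) (\<lambda>n. x (Suc n)) \<in> U}"
      by blast
  qed
  then show ?thesis
    using assms by (simp add: continuous_map_def Pi_def)
qed

lemma continuous_map_with_prelude:
  assumes "continuous_map baire T \<phi>" "z \<in> topspace T" "continuous_map baire T \<psi>"
  shows "continuous_map baire T (with_prelude \<phi> z \<psi>)"
proof -
  define second where "second a b = (if a = 0 then \<phi> else if b = 0 then \<lambda>_. z else \<psi>)"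
    for a b :: nat
  have "continuous_map baire T (second a b)" for a b
    using assms by (simp add: second_def)
  then have "continuous_map baire T (\<lambda>x. second (x 0) (x (Suc 0)) (\<lambda>n. x (Suc (Suc n))))"
    by (simp add: continuous_map_baire_first_move
        [of T "\<lambda>a y. second a (y 0) (\<lambda>n. y (Suc n))", OF continuous_map_baire_first_move])
  then show ?thesis
    by (simp add: with_prelude_def[abs_def] second_def)
qed

lemma range_with_prelude:
  assumes "continuous_map baire T \<phi>" "z \<in> topspace T" "range \<psi> = topspace T"
  shows "range (with_prelude \<phi> z \<psi>) = topspace T"
proof
  have "\<phi> y \<in> topspace T" "\<psi> y \<in> topspace T" for y
    using assms(1,3) by (auto simp: continuous_map_def)
  then show "range (with_prelude \<phi> z \<psi>) \<subseteq> topspace T"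
    using assms(2) by (auto simp: with_prelude_def)
  have "\<psi> y = with_prelude \<phi> z \<psi> (case_nat 1 (case_nat 1 y))" for y
    by (simp add: with_prelude_case_nat)
  then show "topspace T \<subseteq> range (with_prelude \<phi> z \<psi>)"
    using assms(3) by (metis image_subsetI rangeI)
qed

lemma determined_with_prelude:
  assumes "z \<notin> B" "determined (with_prelude \<phi> z \<psi> -` B)"
  shows "determined (\<phi> -` B)"
  using assms(2) by (rule determined_after_two_moves) (simp_all add: with_prelude_case_nat assms(1))

lemma determined_vimage_if_surjections:
  assumes T: "polish T" and \<phi>: "continuous_map baire T \<phi>"
    and surjections: "\<And>\<pi>. continuous_map baire T \<pi> \<Longrightarrow> range \<pi> = topspace T \<Longrightarrow> determined (\<pi> -` B)"
  shows "determined (\<phi> -` B)"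
proof (cases "\<phi> -` B = UNIV")
  case True
  then show ?thesis
    by (simp add: determined_def)
next
  case False
  then obtain y where y: "\<phi> y \<notin> B"
    by blast
  have \<phi>_in: "\<phi> y \<in> topspace T"
    using \<phi> by (simp add: continuous_map_def Pi_iff)
  then obtain \<psi> where \<psi>: "continuous_map baire T \<psi>" "range \<psi> = topspace T"
    using polish_continuous_image_baire[OF T] by blast
  have "determined (with_prelude \<phi> (\<phi> y) \<psi> -` B)"
    by (intro surjections continuous_map_with_prelude range_with_prelude \<phi> \<phi>_in \<psi>)
  then show ?thesis
    by (rule determined_with_prelude[OF y])
qed

proposition equiv_determinacy_imp_pointclass_determinacy:
  assumes \<Gamma>: "reasonable \<Gamma>" and T: "polish T" and E: "E \<subseteq> topspace T \<times> topspace T"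
    and \<phi>: "continuous_map baire T \<phi>" and d: "Delta0_measurable 6 T baire d"
    and d_\<phi>: "\<And>y. d (\<phi> y) = y" and d_invariant: "\<And>x x'. (x, x') \<in> E \<Longrightarrow> d x = d x'"
    and determinacy: "equiv_determinacy \<Gamma> T E"
  shows "pointclass_determinacy \<Gamma>"
  unfolding pointclass_determinacy_def
proof
  fix A assume A: "A \<in> \<Gamma> baire"
  define B where "B = {x \<in> topspace T. d x \<in> A}"
  have "invariant_under E B"
    using E d_invariant by (fastforce simp: invariant_under_def B_def)
  moreover have "in_pointclass \<Gamma> T B"
    unfolding B_def by (rule in_pointclass_Delta0_vimage[OF \<Gamma> T d A])
  moreover have "B \<subseteq> topspace T"
    by (auto simp: B_def)
  ultimately have "determined (\<phi> -` B)"
    using determinacy unfolding equiv_determinacy_def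
    by (intro determined_vimage_if_surjections[OF T \<phi>]) blast
  moreover have "\<phi> -` B = A"
    using \<phi> by (auto simp: B_def d_\<phi> continuous_map_def)
  ultimately show "determined A"
    by simp
qed

section \<open>Sequences determined by their windows\<close>

definition window :: "nat \<Rightarrow> (int \<Rightarrow> 'a) \<Rightarrow> int \<Rightarrow> 'a list" where
  "window n x i = map (\<lambda>t. x (i + int t)) [0..<n]"

lemma length_window [simp]: "length (window n x i) = n"
  by (simp add: window_def)

lemma nth_window [simp]: "t < n \<Longrightarrow> window n x i ! t = x (i + int t)"
  by (simp add: window_def)

lemma window_eqI:
  assumes "\<And>t. 0 \<le> t \<Longrightarrow> t < int n \<Longrightarrow> x (i + t) = y (j + t)"
  shows "window n x i = window n y j"
  using assms by (simp add: window_def)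

lemma take_window: "m \<le> n \<Longrightarrow> take m (window n x i) = window m x i"
  by (simp add: window_def take_map)

lemma window_shift: "window n (\<lambda>k. x (m + k)) i = window n x (m + i)"
  by (simp add: window_def add.assoc)

lemma occurs_in_iff_window: "occurs_in w x \<longleftrightarrow> (\<exists>i. window (length w) x i = w)"
  by (simp add: occurs_in_def list_eq_iff_nth_eq)

lemma closedin_subshift_of_finite_type:
  assumes "subshift_of_finite_type X"
  shows "closedin cantorZ X"
proof -
  obtain W where W: "X = {x. \<forall>w\<in>W. \<not> occurs_in w x}"
    using assms unfolding subshift_of_finite_type_def by blast
  have "openin cantorZ {x. window n x i = w}" for n w i
    unfolding cantorZ_def
  proof (rule openin_finite_dependence)
    fix x y :: "int \<Rightarrow> bool" assume "\<And>k. k \<in> {i..<i + int n} \<Longrightarrow> x k = y k"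
    then have "window n x i = window n y i"
      by (intro window_eqI) simp
    then show "x \<in> {x. window n x i = w} \<longleftrightarrow> y \<in> {x. window n x i = w}"
      by simp
  qed simp
  then have "openin cantorZ (\<Union>w\<in>W. \<Union>i. {x. window (length w) x i = w})"
    by (intro openin_Union) auto
  moreover have "UNIV - X = (\<Union>w\<in>W. \<Union>i. {x. window (length w) x i = w})"
    by (auto simp: W occurs_in_iff_window)
  ultimately show ?thesis
    by (simp add: closedin_def)
qed

definition window_determined :: "nat \<Rightarrow> (int \<Rightarrow> 'a) set \<Rightarrow> bool" where
  "window_determined n X \<longleftrightarrow> (\<forall>y. (\<forall>k. \<exists>x\<in>X. \<exists>i. window n y k = window n x i) \<longrightarrow> y \<in> X)"

lemma window_determinedD:
  assumes "window_determined n X" "\<And>k. \<exists>x\<in>X. \<exists>i. window n y k = window n x i"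
  shows "y \<in> X"
  using assms unfolding window_determined_def by blast

lemma window_determined_shift:
  assumes "window_determined n X" "x \<in> X"
  shows "(\<lambda>k. x (m + k)) \<in> X"
  using assms(2) by (intro window_determinedD[OF assms(1)]) (auto simp: window_shift)

lemma subshift_of_finite_type_imp_window_determined:
  assumes "subshift_of_finite_type X"
  obtains n where "window_determined n X"
proof -
  obtain W where W: "finite W" "X = {x. \<forall>w\<in>W. \<not> occurs_in w x}"
    using assms unfolding subshift_of_finite_type_def by blast
  obtain n where n: "\<And>w. w \<in> W \<Longrightarrow> length w \<le> n"
    using finite_nat_set_iff_bounded_le[of "length ` W"] W(1) by auto
  have "\<not> occurs_in w y"
    if y: "\<forall>k. \<exists>x\<in>X. \<exists>i. window n y k = window n x i" and w: "w \<in> W" for y w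
  proof
    assume "occurs_in w y"
    then obtain k where k: "window (length w) y k = w"
      by (auto simp: occurs_in_iff_window)
    obtain x i where x: "x \<in> X" "window n y k = window n x i"
      using y by blast
    have "window (length w) x i = window (length w) y k"
      using x(2) by (metis take_window[OF n[OF w]])
    then have "occurs_in w x"
      using k by (auto simp: occurs_in_iff_window)
    then show False
      using x(1) w W(2) by blast
  qed
  then have "window_determined n X"
    unfolding window_determined_def W(2) by blast
  then show thesis
    by (rule that)
qed

definition loops :: "nat \<Rightarrow> (int \<Rightarrow> 'a) set \<Rightarrow> int \<Rightarrow> 'a list \<Rightarrow> (int \<Rightarrow> 'a) set" where
  "loops n X q w = {x \<in> X. window n x 0 = w \<and> window n x q = w}"

definition unique_loops :: "nat \<Rightarrow> (int \<Rightarrow> 'a) set \<Rightarrow> bool" where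
  "unique_loops n X \<longleftrightarrow>
     (\<forall>q>0. \<forall>w. \<forall>x\<in>loops n X q w. \<forall>y\<in>loops n X q w. \<forall>k\<in>{0..<q}. x k = y k)"

lemma loops_nth:
  assumes "x \<in> loops n X q w" "0 \<le> t" "t < int n"
  shows "x t = w ! nat t" "x (q + t) = w ! nat t"
proof -
  have "window n x 0 ! nat t = w ! nat t" "window n x q ! nat t = w ! nat t"
    using assms(1) by (simp_all add: loops_def)
  then show "x t = w ! nat t" "x (q + t) = w ! nat t"
    using assms(2,3) by simp_all
qed

lemma shift_in_loops:
  assumes "window_determined n X" "x \<in> X" "window n x i = w" "window n x j = w"
  shows "(\<lambda>k. x (i + k)) \<in> loops n X (j - i) w"
  using assms window_determined_shift[OF assms(1,2)] by (simp add: loops_def window_shift)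

definition concat_blocks :: "int \<Rightarrow> (int \<Rightarrow> int \<Rightarrow> 'a) \<Rightarrow> int \<Rightarrow> 'a" where
  "concat_blocks q f k = f (k div q) (k mod q)"

text \<open>Each block agrees with \<open>f d\<close> even \<open>n\<close> places beyond its end, because the next one starts with
  the same window \<open>w\<close> that \<open>f d\<close> shows there.\<close>

lemma concat_loops_nth:
  assumes q: "q > 0" and f: "\<And>d. f d \<in> loops n X q w" and "0 \<le> r" "r < q + int n"
  shows "concat_blocks q f (d * q + r) = f d r"
  using assms(3,4)
proof (induction "nat r" arbitrary: d r rule: less_induct)
  case less
  show ?case
  proof (cases "r < q")
    case True
    then show ?thesis
      using less.prems by (simp add: concat_blocks_def)
  next
    case False
    then have r: "0 \<le> r - q" "r - q < int n" and "nat (r - q) < nat r"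
      using less.prems q by auto
    then have "concat_blocks q f ((d + 1) * q + (r - q)) = f (d + 1) (r - q)"
      using q by (intro less.hyps) auto
    also have "\<dots> = f d (q + (r - q))"
      by (simp only: loops_nth[OF f r])
    finally show ?thesis
      by (simp add: algebra_simps)
  qed
qed

lemma concat_loops_in:
  assumes "window_determined n X" and q: "q > 0" and f: "\<And>d. f d \<in> loops n X q w"
  shows "concat_blocks q f \<in> X"
proof (rule window_determinedD[OF assms(1)])
  fix k
  have "window n (concat_blocks q f) k = window n (f (k div q)) (k mod q)"
  proof (rule window_eqI)
    fix t assume "0 \<le> t" "t < int n"
    then have "concat_blocks q f (k div q * q + (k mod q + t)) = f (k div q) (k mod q + t)"
      using q pos_mod_bound[OF q, of k] pos_mod_sign[OF q, of k]
      by (intro concat_loops_nth[OF q f]) linarith+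
    then show "concat_blocks q f (k + t) = f (k div q) (k mod q + t)"
      by (simp add: add.assoc[symmetric])
  qed
  then show "\<exists>x\<in>X. \<exists>i. window n (concat_blocks q f) k = window n x i"
    using f by (auto simp: loops_def)
qed

lemma periodic_extension_in_loops:
  assumes "window_determined n X" "q > 0" "x \<in> loops n X q w"
  shows "(\<lambda>k. x (k mod q)) \<in> loops n X (m * q) w"
proof -
  have eq: "(\<lambda>k. x (k mod q)) = concat_blocks q (\<lambda>_. x)"
    by (simp add: concat_blocks_def fun_eq_iff)
  have "window n (concat_blocks q (\<lambda>_. x)) (d * q) = window n x 0" for d
    using assms(2) concat_loops_nth[OF assms(2), of "\<lambda>_. x"] assms(3) by (intro window_eqI) simp
  from this[of 0] this[of m] show ?thesis
    unfolding eq using concat_loops_in[OF assms(1,2), of "\<lambda>_. x"] assms(3) by (simp add: loops_def)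
qed

lemma unique_loops_imp_periodic:
  assumes X: "window_determined n X" and "unique_loops n X"
    and p: "p > 0" "x \<in> loops n X p w" and q: "q > 0" "y \<in> loops n X q w" and k: "0 \<le> k" "k < q"
  shows "y k = x (k mod p)"
proof -
  have "(\<lambda>k. y (k mod q)) \<in> loops n X (p * q) w" "(\<lambda>k. x (k mod p)) \<in> loops n X (p * q) w"
    using periodic_extension_in_loops[OF X q, of p] periodic_extension_in_loops[OF X p, of q]
    by (simp_all add: mult.commute)
  moreover have "p * q > 0" "k < p * q"
    using p(1) q(1) k(2) by (auto intro: less_le_trans simp: mult_le_cancel_right1)
  ultimately have "y (k mod q) = x (k mod p)"
    using assms(2) k(1) unfolding unique_loops_def by force
  then show ?thesis
    using k by simp
qed

lemma unique_loops_imp_periodic_between: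
  assumes X: "window_determined n X" "unique_loops n X" and x: "x \<in> X"
    and w: "window n x i0 = w" "window n x i1 = w" "window n x i = w" "window n x j = w"
    and "i0 < i1" "i \<le> k" "k + (i1 - i0) < j"
  shows "x (k + (i1 - i0)) = x k"
proof -
  have loops: "(\<lambda>k. x (i0 + k)) \<in> loops n X (i1 - i0) w" "(\<lambda>k. x (i + k)) \<in> loops n X (j - i) w"
    using w by (simp_all add: shift_in_loops[OF X(1) x])
  have periodic: "x (i + t) = x (i0 + t mod (i1 - i0))" if "0 \<le> t" "t < j - i" for t
    using unique_loops_imp_periodic[OF X _ loops(1) _ loops(2) that] assms(8) that by simp
  have "x (i + (k - i + (i1 - i0))) = x (i0 + (k - i + (i1 - i0)) mod (i1 - i0))"
    using assms(8-10) by (intro periodic) auto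
  also have "\<dots> = x (i0 + (k - i) mod (i1 - i0))"
    by (simp only: mod_add_self2)
  also have "\<dots> = x (i + (k - i))"
    using assms(8-10) by (intro periodic[symmetric]) auto
  finally show ?thesis
    by (simp add: add.assoc[symmetric])
qed

lemma unique_loops_imp_periodic_along:
  fixes X :: "(int \<Rightarrow> 'a::finite) set"
  assumes X: "window_determined n X" "unique_loops n X" and x: "x \<in> X" and "infinite S"
  obtains I p where "I \<subseteq> S" "infinite I" "p > 0"
    "\<forall>i\<in>I. \<forall>j\<in>I. \<forall>k. i \<le> k \<and> k + p < j \<longrightarrow> x (k + p) = x k"
proof -
  have "finite (window n x ` S)"
    by (rule finite_subset[OF _ finite_lists_length_eq[of UNIV n]]) auto
  then obtain i where i: "infinite {j \<in> S. window n x j = window n x i}" (is "infinite ?I")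
    using pigeonhole_infinite[OF assms(4)] by blast
  then obtain a where a: "a \<in> ?I"
    using infinite_imp_nonempty by blast
  obtain b where b: "b \<in> ?I - {a}"
    using infinite_imp_nonempty[OF infinite_remove[OF i]] by blast
  have min_max: "min a b \<in> ?I" "max a b \<in> ?I" "min a b < max a b"
    using a b by (auto simp: min_def max_def)
  show thesis
  proof (rule that[OF _ i])
    show "\<forall>i\<in>?I. \<forall>j\<in>?I. \<forall>k. i \<le> k \<and> k + (max a b - min a b) < j \<longrightarrow>
        x (k + (max a b - min a b)) = x k"
    proof (intro ballI allI impI)
      fix i' j k assume "i' \<in> ?I" "j \<in> ?I" "i' \<le> k \<and> k + (max a b - min a b) < j"
      then show "x (k + (max a b - min a b)) = x k"
        using min_max unique_loops_imp_periodic_between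
          [OF X x, of "min a b" "window n x i" "max a b" i' j k] by simp
    qed
  qed (use min_max in auto)
qed

lemma countable_eventually_periodic:
  "countable {f :: nat \<Rightarrow> 'a::countable. \<exists>n. \<exists>p>0. \<forall>k\<ge>n. f (k + p) = f k}"
proof -
  define P where "P n p = {f :: nat \<Rightarrow> 'a. \<forall>k\<ge>n. f (k + p) = f k}" for n p
  have "inj_on (\<lambda>f. map f [0..<n + p]) (P n p)" if "p > 0" for n p
  proof (intro inj_onI ext)
    fix f g k assume f: "f \<in> P n p" and g: "g \<in> P n p"
      and eq: "map f [0..<n + p] = map g [0..<n + p]"
    show "f k = g k"
    proof (induction k rule: less_induct)
      case (less k)
      show ?case
      proof (cases "k < n + p")
        case False
        then have "n \<le> k - p"
          by simp
        then have "f (k - p + p) = f (k - p)" "g (k - p + p) = g (k - p)"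
          using f g unfolding P_def by blast+
        then show ?thesis
          using less[of "k - p"] False \<open>p > 0\<close> by simp
      qed (use eq in simp)
    qed
  qed
  then have "countable (P n p)" if "p > 0" for n p
    using that countable_image_inj_on countableI_type by blast
  then have "countable (\<Union>n. \<Union>p\<in>{0<..}. P n p)"
    by (intro countable_UN) auto
  then show ?thesis
    by (rule countable_subset[rotated]) (auto simp: P_def)
qed

lemma countable_biinfinite_eventually_periodic:
  "countable {x :: int \<Rightarrow> 'a::countable.
     (\<exists>p>0. \<exists>i. \<forall>k\<ge>i. x (k + p) = x k) \<and> (\<exists>p>0. \<exists>i. \<forall>k. k + p < i \<longrightarrow> x (k + p) = x k)}"
    (is "countable ?S")
proof -
  let ?P = "{f :: nat \<Rightarrow> 'a. \<exists>n. \<exists>p>0. \<forall>k\<ge>n. f (k + p) = f k}"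
  have "inj_on (\<lambda>x. (\<lambda>k. x (int k), \<lambda>k. x (- int k))) ?S"
  proof (intro inj_onI ext)
    fix x y :: "int \<Rightarrow> 'a" and k
    assume "(\<lambda>k. x (int k), \<lambda>k. x (- int k)) = (\<lambda>k. y (int k), \<lambda>k. y (- int k))"
    then have "x (int m) = y (int m)" "x (- int m) = y (- int m)" for m
      by (auto dest: fun_cong)
    then show "x k = y k"
      by (cases k rule: int_cases2) auto
  qed
  moreover have "(\<lambda>x. (\<lambda>k. x (int k), \<lambda>k. x (- int k))) ` ?S \<subseteq> ?P \<times> ?P"
  proof (intro image_subsetI SigmaI)
    fix x assume x: "x \<in> ?S"
    obtain p i where p: "p > 0" "\<And>k. k \<ge> i \<Longrightarrow> x (k + p) = x k"
      using x by blast
    then have "x (int (k + nat p)) = x (int k)" if "k \<ge> nat i" for k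
      using that by (simp add: nat_le_iff)
    then show "(\<lambda>k. x (int k)) \<in> ?P"
      using p(1) by (intro CollectI exI[of _ "nat i"] exI[of _ "nat p"]) simp
    obtain p j where p: "p > 0" "\<And>k. k + p < j \<Longrightarrow> x (k + p) = x k"
      using x by blast
    have "x (- int (k + nat p)) = x (- int k)" if "k \<ge> nat (1 - j)" for k
      using p(2)[of "- int k - p"] p(1) that by (simp add: nat_le_iff)
    then show "(\<lambda>k. x (- int k)) \<in> ?P"
      using p(1) by (intro CollectI exI[of _ "nat (1 - j)"] exI[of _ "nat p"]) simp
  qed
  moreover have "countable (?P \<times> ?P)"
    by (intro countable_SIGMA countable_eventually_periodic)
  ultimately show ?thesis
    by (meson countable_image_inj_on countable_subset)
qed

lemma unique_loops_imp_countable: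
  fixes X :: "(int \<Rightarrow> 'a::finite) set"
  assumes X: "window_determined n X" "unique_loops n X"
  shows "countable X"
proof (rule countable_subset[OF _ countable_biinfinite_eventually_periodic],
    intro subsetI CollectI conjI)
  fix x assume x: "x \<in> X"
  obtain I p where I: "I \<subseteq> {0..}" "infinite I" "p > 0"
    "\<forall>i\<in>I. \<forall>j\<in>I. \<forall>k. i \<le> k \<and> k + p < j \<longrightarrow> x (k + p) = x k"
    using unique_loops_imp_periodic_along[OF X x infinite_Ici[of 0]] .
  obtain i where "i \<in> I"
    using I(2) infinite_imp_nonempty by blast
  moreover have "\<exists>j\<in>I. k < j" for k
    using I(1,2) finite_subset[of I "{0..k}"] by force
  ultimately show "\<exists>p>0. \<exists>i. \<forall>k\<ge>i. x (k + p) = x k"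
    using I(3,4) by blast
  obtain J q where J: "J \<subseteq> {..0}" "infinite J" "q > 0"
    "\<forall>i\<in>J. \<forall>j\<in>J. \<forall>k. i \<le> k \<and> k + q < j \<longrightarrow> x (k + q) = x k"
    using unique_loops_imp_periodic_along[OF X x infinite_Iic[of 0]] .
  obtain j where "j \<in> J"
    using J(2) infinite_imp_nonempty by blast
  moreover have "\<exists>i\<in>J. i \<le> k" for k
    using J(1,2) finite_subset[of J "{k..0}"] by force
  ultimately show "\<exists>p>0. \<exists>i. \<forall>k. k + p < i \<longrightarrow> x (k + p) = x k"
    using J(3,4) by blast
qed

section \<open>Coding the Baire space by shift orbits\<close>

definition first_break :: "int \<Rightarrow> (int \<Rightarrow> 'a) \<Rightarrow> int \<Rightarrow> bool" where
  "first_break q x i \<longleftrightarrow> x i \<noteq> x (i - q) \<and> (\<forall>t>0. x (i - t) = x (i - t - q))"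

definition marked_blocks :: "int \<Rightarrow> (int \<Rightarrow> 'a) \<Rightarrow> nat set" where
  "marked_blocks q x = {l. \<exists>i. first_break q x i \<and> x (i + (1 + int l) * q) \<noteq> x (i - q)}"

definition decode :: "int \<Rightarrow> (int \<Rightarrow> 'a) \<Rightarrow> nat \<Rightarrow> nat" where
  "decode q x n = (LEAST m. prod_encode (n, m) \<in> marked_blocks q x)"

text \<open>Block \<open>0\<close> serves to place the first break; the graph of \<open>y\<close> is read off the blocks after it.\<close>

definition graph_blocks :: "(nat \<Rightarrow> nat) \<Rightarrow> int set" where
  "graph_blocks y = insert 0 (range (\<lambda>n. 1 + int (prod_encode (n, y n))))"

definition two_blocks :: "int \<Rightarrow> (int \<Rightarrow> 'a) \<Rightarrow> (int \<Rightarrow> 'a) \<Rightarrow> int set \<Rightarrow> int \<Rightarrow> 'a" where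
  "two_blocks q u v C = concat_blocks q (\<lambda>d. if d \<in> C then v else u)"

lemma first_break_unique:
  assumes "first_break q x i" "first_break q x j"
  shows "i = j"
proof -
  have "\<not> i < j" if "first_break q x i" "first_break q x j" for i j
  proof
    assume "i < j"
    then have "x (j - (j - i)) = x (j - (j - i) - q)"
      using that(2) unfolding first_break_def by (meson diff_gt_0_iff_gt)
    then show False
      using that(1) by (simp add: first_break_def)
  qed
  then show ?thesis
    using assms by (meson linorder_neqE)
qed

lemma first_break_shift: "first_break q (\<lambda>k. x (k + m)) i \<longleftrightarrow> first_break q x (i + m)"
  by (simp add: first_break_def algebra_simps)

lemma marked_blocks_shift: "marked_blocks q (\<lambda>k. x (k + m)) = marked_blocks q x"
proof -
  have "(\<exists>i. first_break q x (i + m) \<and> x (i + (1 + int l) * q + m) \<noteq> x (i - q + m)) \<longleftrightarrow>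
      (\<exists>i. first_break q x i \<and> x (i + (1 + int l) * q) \<noteq> x (i - q))"
    (is "(\<exists>i. ?P i) \<longleftrightarrow> (\<exists>i. ?Q i)") for l
  proof -
    have "?P i \<longleftrightarrow> ?Q (i + m)" for i
      by (simp add: algebra_simps)
    then show ?thesis
      by (metis diff_add_cancel)
  qed
  then show ?thesis
    by (simp add: marked_blocks_def first_break_shift)
qed

lemma decode_shift: "decode q (\<lambda>k. x (k + m)) = decode q x"
  by (simp add: decode_def fun_eq_iff marked_blocks_shift)

lemma marked_blocks_Sigma0: "{x. l \<in> marked_blocks q x} \<in> Sigma0 cantorZ 2"
proof -
  have two_coordinates: "closedin cantorZ {x. P (x a) (x b)}" for P a b
    unfolding cantorZ_def by (rule closedin_finite_dependence[of "{a, b}"]) auto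
  have "closedin cantorZ {x. first_break q x i \<and> x (i + (1 + int l) * q) \<noteq> x (i - q)}" for i
  proof -
    have "{x. first_break q x i \<and> x (i + (1 + int l) * q) \<noteq> x (i - q)} =
      {x. x i \<noteq> x (i - q)} \<inter> (\<Inter>t\<in>{0<..}. {x. x (i - t) = x (i - t - q)}) \<inter>
      {x. x (i + (1 + int l) * q) \<noteq> x (i - q)}"
      by (auto simp: first_break_def)
    also have "closedin cantorZ \<dots>"
      by (intro closedin_Int closedin_INT two_coordinates) auto
    finally show ?thesis .
  qed
  then have "(\<Union>i. {x. first_break q x i \<and> x (i + (1 + int l) * q) \<noteq> x (i - q)}) \<in> Sigma0 cantorZ 2"
    by (intro Sigma0_UN closedin_imp_Sigma0_2) auto
  also have "(\<Union>i. {x. first_break q x i \<and> x (i + (1 + int l) * q) \<noteq> x (i - q)}) =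
      {x. l \<in> marked_blocks q x}"
    by (auto simp: marked_blocks_def)
  finally show ?thesis .
qed

lemma decode_measurable: "Delta0_measurable 4 (subtopology cantorZ X) baire (decode q)"
proof -
  have "{x \<in> topspace cantorZ. decode q x n = m} \<in> Sigma0 cantorZ (Suc 2)" for n m
    unfolding decode_def
    by (intro Sigma0_Least metrizable_cantorZ) (simp_all add: marked_blocks_Sigma0)
  then have "Delta0_measurable (Suc (Suc 2)) cantorZ baire (decode q)"
    by (intro Delta0_measurable_baireI metrizable_cantorZ) auto
  then have "Delta0_measurable 4 (subtopology cantorZ X) baire (decode q \<circ> id)"
    by (intro Delta0_measurable_compose_continuous[of _ cantorZ] continuous_map_from_subtopology)
      auto
  then show ?thesis by simp
qed

lemma first_break_two_blocks:
  assumes p: "0 \<le> p" "p < q" "u p \<noteq> v p" and below: "\<And>j. 0 \<le> j \<Longrightarrow> j < p \<Longrightarrow> u j = v j"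
    and C: "0 \<in> C" "C \<subseteq> {0..}"
  shows "first_break q (two_blocks q u v C) p"
proof -
  let ?x = "two_blocks q u v C"
  have neg: "?x j = u (j mod q)" if "j < 0" for j
  proof -
    have "j div q \<notin> C"
      using that p C(2) by (auto simp: pos_imp_zdiv_nonneg_iff)
    then show ?thesis
      by (simp add: two_blocks_def concat_blocks_def)
  qed
  have zero: "?x j = v j" if "0 \<le> j" "j < q" for j
    using that C(1) by (simp add: two_blocks_def concat_blocks_def)
  have before: "?x (j - q) = u j" if "0 \<le> j" "j < q" for j
    using that neg[of "j - q"] by simp
  show ?thesis
    unfolding first_break_def
  proof (intro conjI allI impI)
    show "?x p \<noteq> ?x (p - q)"
      using p zero[of p] before[of p] by simp
    fix t :: int assume "t > 0"
    show "?x (p - t) = ?x (p - t - q)"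
    proof (cases "p - t < 0")
      case True
      then show ?thesis
        using neg[of "p - t"] neg[of "p - t - q"] p by simp
    next
      case False
      then show ?thesis
        using zero[of "p - t"] before[of "p - t"] below[of "p - t"] p(2) \<open>t > 0\<close> by simp
    qed
  qed
qed

lemma marked_blocks_two_blocks:
  assumes "0 \<le> k" "k < q" "u k \<noteq> v k" and C: "0 \<in> C" "C \<subseteq> {0..}"
  shows "marked_blocks q (two_blocks q u v C) = {l. 1 + int l \<in> C}"
proof -
  have "u (int (nat k)) \<noteq> v (int (nat k))"
    using assms(1,3) by simp
  then obtain n where n: "u (int n) \<noteq> v (int n)" "\<And>j. j < n \<Longrightarrow> u (int j) = v (int j)" "n \<le> nat k"
    using exists_least_iff[of "\<lambda>n. u (int n) \<noteq> v (int n)"] by (metis not_le)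
  define p where "p = int n"
  have p: "0 \<le> p" "p < q" "u p \<noteq> v p"
    using n(1,3) assms(1,2) by (auto simp: p_def)
  have "u j = v j" if "0 \<le> j" "j < p" for j
    using n(2)[of "nat j"] that by (simp add: p_def nat_less_iff)
  then have "first_break q (two_blocks q u v C) p"
    by (intro first_break_two_blocks p C)
  then have break: "first_break q (two_blocks q u v C) i \<longleftrightarrow> i = p" for i
    using first_break_unique by blast
  have "two_blocks q u v C (p + d * q) = (if d \<in> C then v else u) p" for d
    using p(1,2) by (simp add: two_blocks_def concat_blocks_def)
  from this[of "-1"] this[of "1 + int l" for l] show ?thesis
    using p(3) C(2) by (auto simp: marked_blocks_def break)
qed

lemma decode_two_blocks:
  assumes "0 \<le> k" "k < q" "u k \<noteq> v k"
  shows "decode q (two_blocks q u v (graph_blocks y)) = y"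
proof -
  have "marked_blocks q (two_blocks q u v (graph_blocks y)) = {l. 1 + int l \<in> graph_blocks y}"
    by (rule marked_blocks_two_blocks[of k q u v, OF assms]) (auto simp: graph_blocks_def)
  moreover have "1 + int (prod_encode (n, m)) \<in> graph_blocks y \<longleftrightarrow> m = y n" for n m
    by (auto simp: graph_blocks_def)
  ultimately show ?thesis
    by (simp add: decode_def fun_eq_iff Least_equality)
qed

lemma continuous_map_two_blocks_graph:
  "continuous_map baire cantorZ (\<lambda>y. two_blocks q u v (graph_blocks y))"
  unfolding baire_def cantorZ_def
proof (rule continuous_map_finite_dependence)
  fix k
  define n where "n = fst (prod_decode (nat (k div q - 1)))"
  have graph_blocks_mono: "k div q \<in> graph_blocks y"
    if "k div q \<in> graph_blocks x" "x n = y n" for x y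
    using that by (auto simp: graph_blocks_def n_def image_iff)
  have "two_blocks q u v (graph_blocks x) k = two_blocks q u v (graph_blocks y) k"
    if "x n = y n" for x y
    using graph_blocks_mono[of x y] graph_blocks_mono[of y x] that
    by (auto simp: two_blocks_def concat_blocks_def)
  then show "\<exists>F. finite F \<and> (\<forall>x y. (\<forall>i\<in>F. x i = y i) \<longrightarrow>
      two_blocks q u v (graph_blocks x) k = two_blocks q u v (graph_blocks y) k)"
    by (intro exI[of _ "{n}"]) blast
qed

proposition uncountable_window_determined_coding:
  assumes X: "window_determined n X" and "uncountable X"
  obtains \<phi> d where "continuous_map baire (subtopology cantorZ X) \<phi>"
    "Delta0_measurable 4 (subtopology cantorZ X) baire d"
    "\<And>y. d (\<phi> y) = y" "\<And>x x'. (x, x') \<in> shift_equiv X \<Longrightarrow> d x = d x'"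
proof -
  have "\<not> unique_loops n X"
    using unique_loops_imp_countable[OF X] assms(2) by blast
  then obtain q w u v k where q: "q > 0" and loops: "u \<in> loops n X q w" "v \<in> loops n X q w"
    and k: "0 \<le> k" "k < q" "u k \<noteq> v k"
    unfolding unique_loops_def by (meson atLeastLessThan_iff)
  have "two_blocks q u v C \<in> X" for C
    unfolding two_blocks_def using loops by (intro concat_loops_in[OF X q]) auto
  then have "continuous_map baire (subtopology cantorZ X) (\<lambda>y. two_blocks q u v (graph_blocks y))"
    using continuous_map_two_blocks_graph by (auto simp: continuous_map_in_subtopology)
  moreover have "decode q x = decode q x'" if equiv: "(x, x') \<in> shift_equiv X" for x x'
  proof -
    obtain m where "x' = (\<lambda>k. x (k + m))"
      using equiv by (auto simp: shift_equiv_def)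
    then show ?thesis
      by (simp add: decode_shift)
  qed
  ultimately show thesis
    by (rule that[OF _ decode_measurable decode_two_blocks[of k q u v, OF k]])
qed

theorem theorem6p1:
  fixes X :: "(int \<Rightarrow> bool) set" and \<Gamma> :: point_family
  assumes "subshift_of_finite_type X"
    and "uncountable (X // shift_equiv X)"
    and "reasonable \<Gamma>"
    and "equiv_determinacy \<Gamma> (subtopology cantorZ X) (shift_equiv X)"
  shows "pointclass_determinacy \<Gamma>"
proof -
  let ?T = "subtopology cantorZ X"
  have T: "polish ?T"
    using closedin_subshift_of_finite_type[OF assms(1)] polish_closed_discrete_power
    by (simp add: cantorZ_def)
  obtain n where "window_determined n X"
    using subshift_of_finite_type_imp_window_determined[OF assms(1)] .
  moreover have "uncountable X"
    using assms(2) by (auto simp: quotient_def)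
  ultimately obtain \<phi> d where \<phi>: "continuous_map baire ?T \<phi>"
    and d: "Delta0_measurable 4 ?T baire d" "\<And>y. d (\<phi> y) = y"
      "\<And>x x'. (x, x') \<in> shift_equiv X \<Longrightarrow> d x = d x'"
    using uncountable_window_determined_coding by blast
  have "Delta0_measurable 6 ?T baire d"
    using Delta0_measurable_mono[OF _ _ _ d(1)] metrizable_cantorZ
    by (simp add: metrizable_space_subtopology)
  moreover have "shift_equiv X \<subseteq> topspace ?T \<times> topspace ?T"
    by (auto simp: shift_equiv_def)
  ultimately show ?thesis
    using equiv_determinacy_imp_pointclass_determinacy[OF assms(3) T _ \<phi> _ d(2,3) assms(4)] by blast
qed

end
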